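(* Fix a real number $a>1$ and $N_1,N_2\in\mathbb{N}\cup\{0\}$. There exists a positive constant $\mathcal{M}_5=\mathcal{M}_5(N_1,N_2)$ such that for every $f\in C^1_{N_1,N_2}$, all $(x,y)\in X$ and all $m,n\in\mathbb{N}$, $$w_{N_1,N_2}(x,y)\,\bigl|\hat{Y}_{m,n,a}(f;x,y)-f(x,y)\bigr|\le \mathcal{M}_5(N_1,N_2)\Bigl\{\|f'_x\|_{N_1,N_2}\,\delta'_m(x)+\|f'_y\|_{N_1,N_2}\,\delta'_n(y)\Bigr\},$$ where $\delta'_m(x)=\sqrt{\frac{x(1+x)}{m}}$, $\delta'_n(y)=\sqrt{\frac{y(1+y)}{n}}$, and $f'_x=\frac{\partial f}{\partial x}$, $f'_y=\frac{\partial f}{\partial y}$.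
   Context: $\mathbb{N}=\{1,2,3,\dots\}$ and $X=[0,\infty)\times[0,\infty)$. Weights: $w_0(x)=1$ and $w_N(x)=(1+x^N)^{-1}$ for $N\in\mathbb{N}$, $x\ge 0$; and $w_{N_1,N_2}(x,y)=w_{N_1}(x)w_{N_2}(y)$. $C_{N_1,N_2}$ is the set of all continuous functions $f:X\to\mathbb{R}$ such that $w_{N_1,N_2}f$ is uniformly continuous and bounded on $X$, with norm $\|f\|_{N_1,N_2}=\sup_{x,y\ge 0}w_{N_1,N_2}(x,y)|f(x,y)|$. $C^1_{N_1,N_2}=\{f\in C_{N_1,N_2}:\ \partial f/\partial x,\ \partial f/\partial y\in C_{N_1,N_2}\}$ (partial derivatives at boundary points of $X$ are one-sided). Operators: the parameter $a>1$ is fixed throughout (constants may depend on it). For $m,n\in\mathbb{N}$ and $(x,y)\in X$, $$\hat{Y}_{m,n,a}(f;x,y)=\sum_{k_1=0}^{\infty}\sum_{k_2=0}^{\infty}a^{\frac{-x}{a^{1/m}-1}}\,a^{\frac{-y}{a^{1/n}-1}}\,\frac{x^{k_1}y^{k_2}(\log a)^{k_1+k_2}}{(a^{1/m}-1)^{k_1}(a^{1/n}-1)^{k_2}\,k_1!\,k_2!}\;f\!\left(\frac{k_1}{m},\frac{k_2}{n}\right),$$ with the convention $0^0=1$. *)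

theory Defs
  imports "HOL-Analysis.Analysis"
begin

text \<open>
  Functions on the closed quadrant are total functions on \<^typ>\<open>real \<times> real\<close>; every notion below
  depends only on their values on \<open>quadrant\<close>.
\<close>

definition quadrant :: "(real \<times> real) set" where
  "quadrant = {0..} \<times> {0..}"

text \<open>The weight of index 0 is 1, not the value 1/2 that the general formula would give.\<close>

definition weight :: "nat \<Rightarrow> real \<Rightarrow> real" where
  "weight N x = (if N = 0 then 1 else inverse (1 + x ^ N))"

definition weight2 :: "nat \<Rightarrow> nat \<Rightarrow> real \<times> real \<Rightarrow> real" where
  "weight2 N1 N2 = (\<lambda>(x, y). weight N1 x * weight N2 y)"

definition wspace :: "nat \<Rightarrow> nat \<Rightarrow> (real \<times> real \<Rightarrow> real) set" where
  "wspace N1 N2 = {f. continuous_on quadrant f \<and>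
     uniformly_continuous_on quadrant (\<lambda>p. weight2 N1 N2 p * f p) \<and>
     bounded ((\<lambda>p. weight2 N1 N2 p * f p) ` quadrant)}"

definition wnorm :: "nat \<Rightarrow> nat \<Rightarrow> (real \<times> real \<Rightarrow> real) \<Rightarrow> real" where
  "wnorm N1 N2 f = (SUP p\<in>quadrant. weight2 N1 N2 p * \<bar>f p\<bar>)"

text \<open>
  Derivatives within \<open>{0..}\<close> are two-sided at positive points and right-sided at 0.
\<close>

definition partial_x :: "(real \<times> real \<Rightarrow> real) \<Rightarrow> real \<times> real \<Rightarrow> real" where
  "partial_x f = (\<lambda>(x, y). vector_derivative (\<lambda>s. f (s, y)) (at x within {0..}))"

definition partial_y :: "(real \<times> real \<Rightarrow> real) \<Rightarrow> real \<times> real \<Rightarrow> real" where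
  "partial_y f = (\<lambda>(x, y). vector_derivative (\<lambda>t. f (x, t)) (at y within {0..}))"

definition wspace1 :: "nat \<Rightarrow> nat \<Rightarrow> (real \<times> real \<Rightarrow> real) set" where
  "wspace1 N1 N2 = {f \<in> wspace N1 N2.
     (\<forall>(x, y)\<in>quadrant. (\<lambda>s. f (s, y)) differentiable (at x within {0..}) \<and>
                        (\<lambda>t. f (x, t)) differentiable (at y within {0..})) \<and>
     partial_x f \<in> wspace N1 N2 \<and> partial_y f \<in> wspace N1 N2}"

text \<open>
  For \<open>f\<close> in any \<open>wspace N1 N2\<close> the double series converges absolutely (polynomial growth against
  Poisson weights), so the iterated sum below is not affected by the default value of
  \<^const>\<open>suminf\<close> on divergent series.
\<close>

definition Y_op :: "real \<Rightarrow> nat \<Rightarrow> nat \<Rightarrow> (real \<times> real \<Rightarrow> real) \<Rightarrow> real \<times> real \<Rightarrow> real" where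
  "Y_op a m n f = (\<lambda>(x, y). \<Sum>k1. \<Sum>k2.
     a powr (- x / (a powr (1 / real m) - 1)) * a powr (- y / (a powr (1 / real n) - 1)) *
     ((x ^ k1 * y ^ k2 * ln a ^ (k1 + k2)) /
      ((a powr (1 / real m) - 1) ^ k1 * (a powr (1 / real n) - 1) ^ k2 * fact k1 * fact k2)) *
     f (real k1 / real m, real k2 / real n))"

definition delta' :: "nat \<Rightarrow> real \<Rightarrow> real" where
  "delta' m x = sqrt (x * (1 + x) / real m)"

end

theory Submission
  imports Defs
begin

text \<open>
  The operator averages \<open>f (K/m, L/n)\<close> over independent Poisson variables \<open>K\<close>, \<open>L\<close>.  With
  \<open>t = ln a / m\<close> and \<open>r = t / (exp t - 1)\<close>, the variable \<open>K\<close> has mean \<open>m r x\<close>, and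
  \<open>1 - t \<le> r \<le> 1\<close> gives \<open>E (K/m - x)\<^sup>2 = r x / m + (1 - r)\<^sup>2 x\<^sup>2 \<le> (1 + ln a) x (1 + x) / m\<close>.
  The mean value theorem, applied in each variable, bounds \<open>f (s, t) - f (x, y)\<close> by
  \<open>\<bar>s - x\<bar>\<close> and \<open>\<bar>t - y\<bar>\<close> times reciprocal weights.  These have polynomial growth, so their
  Poisson averages are comparable to their values at \<open>x\<close> and \<open>y\<close>, and the second-moment estimate
  together with the inequality \<open>2 u v \<le> \<epsilon> u\<^sup>2 + v\<^sup>2 / \<epsilon>\<close> concludes.
\<close>

section \<open>Averages with respect to a probability sequence\<close>

text \<open>Total mass 1 turns the difference into the average of \<open>F k - c\<close>, which the
  series of \<open>p k * e k\<close> dominates. The domination also gives convergence, so the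
  default value of \<open>suminf\<close> never enters.\<close>

lemma average_deviation:
  fixes p F e :: "nat \<Rightarrow> real"
  assumes p: "\<And>k. 0 \<le> p k" "p sums 1"
    and F: "\<And>k. \<bar>F k - c\<bar> \<le> e k"
    and e: "(\<lambda>k. p k * e k) sums E"
  shows "summable (\<lambda>k. p k * F k)" and "\<bar>(\<Sum>k. p k * F k) - c\<bar> \<le> E"
proof -
  have le: "norm (p k * (F k - c)) \<le> p k * e k" for k
    using p(1)[of k] F[of k] by (simp add: abs_mult mult_left_mono)
  have sm: "summable (\<lambda>k. p k * (F k - c))"
    by (rule summable_comparison_test'[of _ 0]) (use e le in \<open>auto simp: sums_iff\<close>)
  have "(\<lambda>k. p k * (F k - c) + p k * c) sums ((\<Sum>k. p k * (F k - c)) + 1 * c)"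
    by (intro sums_add sums_mult2 p(2) summable_sums sm)
  then have s: "(\<lambda>k. p k * F k) sums ((\<Sum>k. p k * (F k - c)) + c)"
    by (simp add: algebra_simps)
  show "summable (\<lambda>k. p k * F k)"
    using s by (simp add: sums_iff)
  have "norm (\<Sum>k. p k * (F k - c)) \<le> (\<Sum>k. p k * e k)"
    by (rule norm_suminf_le) (use e le in \<open>auto simp: sums_iff\<close>)
  then show "\<bar>(\<Sum>k. p k * F k) - c\<bar> \<le> E"
    using s e by (simp add: sums_iff)
qed

text \<open>Two uses of \<open>average_deviation\<close>: the error bound of the inner average at
  fixed \<open>k\<close> serves as the dominating sequence of the outer one. The first error term
  factors into one function of each index, so its double average is the product
  \<open>G * H\<close>.\<close>

lemma double_average_deviation:
  fixes p q g h u :: "nat \<Rightarrow> real" and F :: "nat \<Rightarrow> nat \<Rightarrow> real"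
  assumes p: "\<And>k. 0 \<le> p k" "p sums 1"
    and q: "\<And>k. 0 \<le> q k" "q sums 1"
    and F: "\<And>k l. \<bar>F k l - c\<bar> \<le> A * (g k * h l) + B * u l"
    and g: "(\<lambda>k. p k * g k) sums G"
    and h: "(\<lambda>l. q l * h l) sums H"
    and u: "(\<lambda>l. q l * u l) sums U"
  shows "\<bar>(\<Sum>k. \<Sum>l. p k * q l * F k l) - c\<bar> \<le> A * (G * H) + B * U"
proof -
  define I where "I k = (\<Sum>l. q l * F k l)" for k
  have inner: "(\<lambda>l. q l * (A * (g k * h l) + B * u l)) sums (A * (g k * H) + B * U)" for k
    using sums_add[OF sums_mult[OF h, of "A * g k"] sums_mult[OF u, of B]]
    by (simp add: algebra_simps)
  have sm: "summable (\<lambda>l. q l * F k l)" and I: "\<bar>I k - c\<bar> \<le> A * (g k * H) + B * U" for k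
    using average_deviation[OF q F inner] unfolding I_def by auto
  have "(\<lambda>k. p k * (A * (g k * H) + B * U)) sums (A * (G * H) + B * U)"
    using sums_add[OF sums_mult[OF g, of "A * H"] sums_mult[OF p(2), of "B * U"]]
    by (simp add: algebra_simps)
  then have "\<bar>(\<Sum>k. p k * I k) - c\<bar> \<le> A * (G * H) + B * U"
    by (rule average_deviation(2)[OF p I])
  \<comment> \<open>Pulling \<open>p k\<close> out of \<open>suminf\<close> relies on the
    convergence of the inner series just obtained.\<close>
  moreover have "(\<Sum>l. p k * q l * F k l) = p k * I k" for k
    using suminf_mult[OF sm, of "p k" k] by (simp add: I_def mult.assoc)
  ultimately show ?thesis by simp
qed

section \<open>Poisson weights and their moments\<close>

definition poisson_weight :: "real \<Rightarrow> nat \<Rightarrow> real" where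
  "poisson_weight \<theta> k = exp (- \<theta>) * \<theta> ^ k / fact k"

lemma poisson_weight_nonneg: "0 \<le> \<theta> \<Longrightarrow> 0 \<le> poisson_weight \<theta> k"
  by (simp add: poisson_weight_def)

lemma poisson_weight_sums: "poisson_weight \<theta> sums 1"
  using sums_mult[OF exp_converges[of \<theta>], of "exp (- \<theta>)"]
  by (simp add: poisson_weight_def[abs_def] divide_inverse mult_ac exp_minus_inverse)

text \<open>The identity \<open>E (K * h K) = \<theta> * E (h (K + 1))\<close>, from
  \<open>(k + 1) / (k + 1)! = 1 / k!\<close>. It lowers the degree of a moment by one and drives all
  moment computations.\<close>

lemma poisson_weight_shift:
  assumes "(\<lambda>k. poisson_weight \<theta> k * h (Suc k)) sums S"
  shows "(\<lambda>k. poisson_weight \<theta> k * (real k * h k)) sums (\<theta> * S)"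
proof -
  have "poisson_weight \<theta> (Suc k) * (real (Suc k) * h (Suc k))
      = \<theta> * (poisson_weight \<theta> k * h (Suc k))" for k
    by (simp add: poisson_weight_def divide_simps del: of_nat_Suc)
  then have "(\<lambda>k. poisson_weight \<theta> (Suc k) * (real (Suc k) * h (Suc k))) sums (\<theta> * S)"
    using sums_mult[OF assms, of \<theta>] by (simp only:)
  then show ?thesis
    \<comment> \<open>The term at index 0 vanishes because of the factor
      \<open>real k\<close>.\<close>
    by (subst (asm) sums_Suc_iff) simp
qed

text \<open>Variance plus squared bias: the square is expanded and the raw moments come from the
  shift identity with \<open>h = 1\<close> and \<open>h k = k\<close>.\<close>

lemma poisson_second_moment:
  fixes m :: nat and \<mu> x :: real
  assumes "m \<ge> 1"
  shows "(\<lambda>k. poisson_weight (m * \<mu>) k * (k / m - x)\<^sup>2) sums (\<mu> / m + (\<mu> - x)\<^sup>2)"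
proof -
  let ?p = "poisson_weight (m * \<mu>)"
  have 0: "?p sums 1" by (rule poisson_weight_sums)
  have 1: "(\<lambda>k. ?p k * real k) sums (m * \<mu>)"
    using poisson_weight_shift[of "m * \<mu>" "\<lambda>_. 1" 1] 0 by simp
  have "(\<lambda>k. ?p k * real (Suc k)) sums (m * \<mu> + 1)"
    using sums_add[OF 1 0] by (simp add: algebra_simps)
  from poisson_weight_shift[OF this]
  have 2: "(\<lambda>k. ?p k * (real k * real k)) sums (m * \<mu> * (m * \<mu> + 1))" .
  have "(\<lambda>k. inverse (m\<^sup>2) * (?p k * (real k * real k)) + (- 2 * x / m) * (?p k * real k) + x\<^sup>2 * ?p k)
     sums (inverse (m\<^sup>2) * (m * \<mu> * (m * \<mu> + 1)) + (- 2 * x / m) * (m * \<mu>) + x\<^sup>2 * 1)"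
    by (intro sums_add sums_mult 0 1 2)
  moreover have "inverse (m\<^sup>2) * (m * \<mu> * (m * \<mu> + 1)) + (- 2 * x / m) * (m * \<mu>) + x\<^sup>2 * 1
      = \<mu> / m + (\<mu> - x)\<^sup>2"
    using assms by (simp add: field_simps power2_eq_square)
  moreover have "inverse (m\<^sup>2) * (?p k * (real k * real k)) + (- 2 * x / m) * (?p k * real k)
      + x\<^sup>2 * ?p k = ?p k * (k / m - x)\<^sup>2" for k
    using assms by (simp add: field_simps power2_eq_square)
  ultimately show ?thesis by simp
qed

lemma power_add_le_two_power:
  fixes u v :: real
  assumes "0 \<le> u" "0 \<le> v"
  shows "(u + v) ^ q \<le> 2 ^ q * (u ^ q + v ^ q)"
proof -
  have "(u + v) ^ q \<le> (2 * max u v) ^ q"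
    using assms by (intro power_mono) auto
  also have "\<dots> = 2 ^ q * max u v ^ q" by (simp add: power_mult_distrib)
  also have "\<dots> \<le> 2 ^ q * (u ^ q + v ^ q)"
    using assms by (auto simp: max_def)
  finally show ?thesis .
qed

lemma le_one_plus_power_Suc:
  fixes x :: real
  assumes "0 \<le> x"
  shows "x \<le> 1 + x ^ Suc q"
proof (cases "x \<le> 1")
  case True
  then show ?thesis using assms by (simp add: add_increasing2)
next
  case False
  then have "x ^ 1 \<le> x ^ Suc q" by (intro power_increasing) auto
  then show ?thesis by simp
qed

text \<open>The recursion is read off from the induction for the moment bound: \<open>2 ^ q\<close>
  from separating \<open>K/m\<close> and 1 in a power, \<open>2 * moment_const q + 1\<close> from
  absorbing \<open>x\<close> into \<open>1 + x ^ Suc q\<close>.\<close>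

primrec moment_const :: "nat \<Rightarrow> real" where
  "moment_const 0 = 1"
| "moment_const (Suc q) = 2 ^ q * (2 * moment_const q + 1)"

lemma moment_const_nonneg: "0 \<le> moment_const q"
  by (induction q) auto

text \<open>By the shift identity the moment of order \<open>q + 1\<close> is \<open>\<mu>\<close>
  times the average of \<open>((K + 1) / m) ^ q\<close>, and
  \<open>(K + 1) / m \<le> K / m + 1\<close>. The bound is uniform in \<open>m\<close> and
  \<open>\<mu>\<close>.\<close>

lemma poisson_moment_bound:
  fixes m :: nat and \<mu> x :: real
  assumes "1 \<le> m" "0 \<le> \<mu>" "\<mu> \<le> x"
  shows "\<exists>S. (\<lambda>k. poisson_weight (real m * \<mu>) k * (real k / real m) ^ q) sums S \<and>
    S \<le> moment_const q * (1 + x ^ q)"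
proof (induction q)
  case 0
  show ?case
    by (intro exI[of _ 1] conjI) (simp_all add: poisson_weight_sums)
next
  case (Suc q)
  let ?C = "moment_const q" and ?p = "poisson_weight (real m * \<mu>)"
  obtain S where S: "(\<lambda>k. ?p k * (real k / real m) ^ q) sums S" "S \<le> ?C * (1 + x ^ q)"
    using Suc.IH by blast
  have p0: "0 \<le> ?p k" for k using assms by (simp add: poisson_weight_nonneg)
  have S': "(\<lambda>k. ?p k * (2 ^ q * ((real k / real m) ^ q + 1))) sums (2 ^ q * (S + 1))"
    using sums_mult[OF sums_add[OF S(1) poisson_weight_sums[of "real m * \<mu>"]], of "2 ^ q"]
    by (simp add: algebra_simps)
  have le: "?p k * (real (Suc k) / real m) ^ q \<le> ?p k * (2 ^ q * ((real k / real m) ^ q + 1))" for k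
  proof (rule mult_left_mono[OF _ p0])
    have "(real (Suc k) / real m) ^ q \<le> (real k / real m + 1) ^ q"
      using assms by (intro power_mono) (auto simp: field_simps)
    also have "\<dots> \<le> 2 ^ q * ((real k / real m) ^ q + 1)"
      using power_add_le_two_power[of "real k / real m" 1 q] by simp
    finally show "(real (Suc k) / real m) ^ q \<le> 2 ^ q * ((real k / real m) ^ q + 1)" .
  qed
  have "summable (\<lambda>k. ?p k * (real (Suc k) / real m) ^ q)"
    by (rule summable_comparison_test'[of _ 0]) (use S' le p0 in \<open>auto simp: sums_iff\<close>)
  then obtain T where T: "(\<lambda>k. ?p k * (real (Suc k) / real m) ^ q) sums T"
    by (auto simp: summable_def)
  have T_le: "T \<le> 2 ^ q * (S + 1)" by (rule sums_le[OF le T S'])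
  \<comment> \<open>The sign of \<open>T\<close> permits replacing \<open>\<mu>\<close> by the
    larger \<open>x\<close> below.\<close>
  have T0: "0 \<le> T" by (rule sums_le[OF _ sums_zero T]) (use p0 in auto)
  have "(\<lambda>k. ?p k * (real k * (real k / real m) ^ q)) sums (real m * \<mu> * T)"
    using poisson_weight_shift[OF T] .
  from sums_mult[OF this, of "inverse m"]
  have "(\<lambda>k. ?p k * (real k / real m) ^ Suc q) sums (\<mu> * T)"
    using assms by (simp add: field_simps)
  moreover have "\<mu> * T \<le> (2 ^ q * (2 * ?C + 1)) * (1 + x ^ Suc q)"
  proof -
    have x0: "0 \<le> x" using assms by simp
    have "\<mu> * T \<le> x * T" using assms T0 by (intro mult_right_mono)
    also have "\<dots> \<le> x * (2 ^ q * (?C * (1 + x ^ q) + 1))"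
      using T_le S(2) x0
      by (intro mult_left_mono order_trans[OF T_le]) auto
    also have "\<dots> = 2 ^ q * (?C * (x + x ^ Suc q) + x)" by (simp add: algebra_simps)
    also have "\<dots> \<le> 2 ^ q * (?C * (2 * (1 + x ^ Suc q)) + (1 + x ^ Suc q))"
    proof -
      have "x + x ^ Suc q \<le> 2 * (1 + x ^ Suc q)"
        using le_one_plus_power_Suc[OF x0, of q] zero_le_power[OF x0, of "Suc q"]
          unfolding distrib_left by linarith
      then show ?thesis
        using le_one_plus_power_Suc[OF x0, of q] moment_const_nonneg[of q]
        by (intro mult_left_mono add_mono) auto
    qed
    also have "\<dots> = (2 ^ q * (2 * ?C + 1)) * (1 + x ^ Suc q)" by (simp add: algebra_simps)
    finally show ?thesis .
  qed
  ultimately show ?case by auto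
qed

section \<open>Weights\<close>

lemma weight_pos: "0 \<le> x \<Longrightarrow> 0 < weight N x"
  by (simp add: weight_def add_pos_nonneg)

lemma weight_le_1: "0 \<le> x \<Longrightarrow> weight N x \<le> 1"
  by (simp add: weight_def field_simps add_pos_nonneg)

text \<open>Equality for positive \<open>N\<close>; for \<open>N = 0\<close> the two sides are 1 and
  2. This exception is also the source of the 2 in \<open>weight_mult_le\<close>.\<close>

lemma inverse_weight_le: "0 \<le> x \<Longrightarrow> inverse (weight N x) \<le> 1 + x ^ N"
  by (simp add: weight_def)

lemma inverse_weight_mono: "0 \<le> x \<Longrightarrow> x \<le> y \<Longrightarrow> inverse (weight N x) \<le> inverse (weight N y)"
  by (simp add: weight_def power_mono)

lemma weight_mult_le: "0 \<le> x \<Longrightarrow> weight N x * (1 + x ^ N) \<le> 2"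
  using zero_le_power[of x N] by (simp add: weight_def add_nonneg_eq_0_iff)

lemma weight_power2_mult_le:
  assumes "0 \<le> x"
  shows "(weight N x)\<^sup>2 * (1 + x ^ (2 * N)) \<le> 4"
proof -
  have "1 + x ^ (2 * N) \<le> (1 + x ^ N)\<^sup>2"
    using zero_le_power[OF assms, of N]
    by (simp add: power_even_eq power2_sum)
  then have "(weight N x)\<^sup>2 * (1 + x ^ (2 * N)) \<le> (weight N x)\<^sup>2 * (1 + x ^ N)\<^sup>2"
    by (intro mult_left_mono) auto
  also have "\<dots> = (weight N x * (1 + x ^ N))\<^sup>2" by (simp add: power_mult_distrib)
  also have "\<dots> \<le> 2\<^sup>2"
    using weight_mult_le[OF assms, of N] weight_pos[OF assms, of N] assms
    by (intro power_mono) auto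
  finally show ?thesis by simp
qed

lemma inverse_weight_power2_le:
  assumes "0 \<le> x"
  shows "(inverse (weight N x))\<^sup>2 \<le> 2 * (1 + x ^ (2 * N))"
proof -
  have "(inverse (weight N x))\<^sup>2 \<le> (1 + x ^ N)\<^sup>2"
    using inverse_weight_le[OF assms, of N] weight_pos[OF assms, of N] by (intro power_mono) auto
  also have "\<dots> \<le> 2 * (1 + x ^ (2 * N))"
    using sum_squares_bound[of 1 "x ^ N"]
    by (simp add: power_even_eq power2_sum)
  finally show ?thesis .
qed

text \<open>The reciprocal weight grows at most like \<open>1 + s ^ N\<close>, whose Poisson average
  is bounded by a multiple of \<open>1 + x ^ N\<close>; the factor \<open>weight N x\<close> cancels
  this growth.\<close>

lemma poisson_inverse_weight_bound:
  obtains D :: real where "0 < D"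
    and "\<And>m \<mu> x. \<lbrakk>1 \<le> m; 0 \<le> \<mu>; \<mu> \<le> x\<rbrakk> \<Longrightarrow>
      \<exists>H. (\<lambda>k. poisson_weight (real m * \<mu>) k * inverse (weight N (real k / real m))) sums H \<and>
        weight N x * H \<le> D"
proof -
  define C where "C = moment_const (N)"
  have C: "0 \<le> C" by (simp add: C_def moment_const_nonneg)
  have "\<exists>H. (\<lambda>k. poisson_weight (real m * \<mu>) k * inverse (weight N (real k / real m))) sums H \<and>
        weight N x * H \<le> 1 + C * 2"
    if m: "1 \<le> m" and \<mu>: "0 \<le> \<mu>" "\<mu> \<le> x" for m :: nat and \<mu> x :: real
  proof -
    let ?p = "poisson_weight (real m * \<mu>)" and ?e = "\<lambda>k. inverse (weight N (real k / real m))"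
    have p0: "0 \<le> ?p k" for k using \<mu> by (simp add: poisson_weight_nonneg)
    have x0: "0 \<le> x" using that by simp
    obtain S where S: "(\<lambda>k. ?p k * (real k / real m) ^ N) sums S" "S \<le> C * (1 + x ^ N)"
      using poisson_moment_bound[OF m \<mu>] unfolding C_def by blast
    have S': "(\<lambda>k. ?p k * (1 + (real k / real m) ^ N)) sums (1 + S)"
      using sums_add[OF poisson_weight_sums S(1)] by (simp add: algebra_simps)
    have le: "?p k * ?e k \<le> ?p k * (1 + (real k / real m) ^ N)" for k
      by (intro mult_left_mono p0 inverse_weight_le) auto
    have e0: "0 \<le> ?e k" for k
      using weight_pos[of "real k / real m" N] by simp
    have "summable (\<lambda>k. ?p k * ?e k)"
      by (rule summable_comparison_test'[of _ 0])
        (use S' le p0 e0 in \<open>auto simp: sums_iff abs_mult\<close>)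
    then obtain H where H: "(\<lambda>k. ?p k * ?e k) sums H"
      by (auto simp: summable_def)
    have "H \<le> 1 + S" by (rule sums_le[OF le H S'])
    then have "weight N x * H \<le> weight N x * (1 + C * (1 + x ^ N))"
      using S(2) weight_pos[OF x0, of N] by (intro mult_left_mono) auto
    also have "\<dots> = weight N x + C * (weight N x * (1 + x ^ N))" by (simp add: algebra_simps)
    also have "\<dots> \<le> 1 + C * 2"
      by (intro add_mono mult_left_mono weight_le_1 weight_mult_le x0 C)
    finally show ?thesis using H by blast
  qed
  then show ?thesis using that[of "1 + C * 2"] C by auto
qed

text \<open>
  Here \<open>\<mu>\<close> is the mean of \<open>K/m\<close> and \<open>V\<close> relates the second moment about \<open>x\<close> to \<open>delta'\<close>.  The free parameter
  \<open>\<epsilon> > delta' m x\<close> in the proof, in place of \<open>delta' m x\<close> itself, avoids dividing by zero at \<open>x = 0\<close>.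
\<close>

lemma poisson_weighted_deviation_bound:
  fixes V :: real
  assumes V: "0 \<le> V"
  obtains C :: real where "0 < C"
    and "\<And>m \<mu> x. \<lbrakk>1 \<le> m; 0 \<le> \<mu>; \<mu> \<le> x; \<mu> / real m + (\<mu> - x)\<^sup>2 \<le> V * (delta' m x)\<^sup>2\<rbrakk> \<Longrightarrow>
      \<exists>G. (\<lambda>k. poisson_weight (real m * \<mu>) k *
            (\<bar>real k / real m - x\<bar> * (inverse (weight N x) + inverse (weight N (real k / real m))))) sums G \<and>
        weight N x * G \<le> C * delta' m x"
proof -
  \<comment> \<open>Order \<open>2 * N\<close>, because the square of the reciprocal weight gets
    averaged.\<close>
  define C where "C = moment_const (2 * N)"
  have C: "0 \<le> C" by (simp add: C_def moment_const_nonneg)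
  \<comment> \<open>The 3 bounds \<open>1 + 2 * ?w\<^sup>2\<close>, the term \<open>C * 8\<close>
    bounds \<open>2 * ?w\<^sup>2 * S\<close>, and \<open>V\<close> comes from the second
    moment.\<close>
  let ?C = "3 + C * 8 + V"
  have "\<exists>G. (\<lambda>k. poisson_weight (real m * \<mu>) k *
            (\<bar>real k / real m - x\<bar> * (inverse (weight N x) + inverse (weight N (real k / real m))))) sums G \<and>
        weight N x * G \<le> ?C * delta' m x"
    if m: "1 \<le> m" and \<mu>: "0 \<le> \<mu>" "\<mu> \<le> x" and var: "\<mu> / real m + (\<mu> - x)\<^sup>2 \<le> V * (delta' m x)\<^sup>2"
    for m :: nat and \<mu> x :: real
  proof -
    let ?p = "poisson_weight (real m * \<mu>)" and ?s = "\<lambda>k. real k / real m"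
    let ?w = "weight N x"
    let ?e = "\<lambda>k. \<bar>?s k - x\<bar> * (inverse ?w + inverse (weight N (?s k)))"
    have p0: "0 \<le> ?p k" for k using \<mu> by (simp add: poisson_weight_nonneg)
    have x0: "0 \<le> x" using \<mu> by simp
    have w0: "0 < ?w" by (rule weight_pos[OF x0])
    have e0: "0 \<le> ?e k" for k
      using weight_pos[of "real k / real m" N] w0 by simp
    obtain S where S: "(\<lambda>k. ?p k * ?s k ^ (2 * N)) sums S" "S \<le> C * (1 + x ^ (2 * N))"
      using poisson_moment_bound[OF m \<mu>] unfolding C_def by blast
    have bound: "?w * ?e k \<le> \<epsilon> * (1 + ?w\<^sup>2 * (2 * (1 + ?s k ^ (2 * N)))) + inverse \<epsilon> * (?s k - x)\<^sup>2"
      if "0 < \<epsilon>" for \<epsilon> k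
    proof -
      define v where "v = ?w * inverse (weight N (?s k))"
      define d where "d = \<bar>?s k - x\<bar>"
      have "?w * ?e k = d * (1 + v)"
        using w0 by (simp add: v_def d_def algebra_simps)
      also have "\<dots> \<le> \<epsilon> * (1 + v\<^sup>2) + inverse \<epsilon> * d\<^sup>2"
      proof -
        \<comment> \<open>Completing the square separates the deviation \<open>d\<close> from the
          weight ratio \<open>v\<close>, so that each is controlled by its own moment.\<close>
        have "0 \<le> (\<epsilon> * (1 + v) / 2 - d)\<^sup>2" by simp
        then have "\<epsilon> * (d * (1 + v)) \<le> \<epsilon>\<^sup>2 * ((1 + v)\<^sup>2 / 4) + d\<^sup>2"
          by (simp add: power2_eq_square algebra_simps)
        also have "\<dots> \<le> \<epsilon>\<^sup>2 * (1 + v\<^sup>2) + d\<^sup>2"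
        proof -
          have "(1 + v)\<^sup>2 / 4 \<le> 1 + v\<^sup>2"
          proof -
            have "2 * v \<le> 1 + v\<^sup>2" using sum_squares_bound[of 1 v] by simp
            moreover have "(1 + v)\<^sup>2 = 1 + 2 * v + v\<^sup>2" by (simp add: power2_sum)
            ultimately show ?thesis using zero_le_power2[of v] by linarith
          qed
          then show ?thesis by (intro add_right_mono mult_left_mono) auto
        qed
        also have "\<dots> = \<epsilon> * (\<epsilon> * (1 + v\<^sup>2) + inverse \<epsilon> * d\<^sup>2)"
          using that by (simp add: field_simps power2_eq_square)
        finally show ?thesis using that by simp
      qed
      also have "\<dots> \<le> \<epsilon> * (1 + ?w\<^sup>2 * (2 * (1 + ?s k ^ (2 * N)))) + inverse \<epsilon> * d\<^sup>2"
        unfolding v_def power_mult_distrib using that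
        by (intro add_right_mono mult_left_mono add_left_mono inverse_weight_power2_le) auto
      finally show ?thesis by (simp add: d_def)
    qed
    have rhs: "(\<lambda>k. ?p k * (\<epsilon> * (1 + ?w\<^sup>2 * (2 * (1 + ?s k ^ (2 * N)))) + inverse \<epsilon> * (?s k - x)\<^sup>2))
        sums (\<epsilon> * (1 + 2 * ?w\<^sup>2 + 2 * ?w\<^sup>2 * S) + inverse \<epsilon> * (\<mu> / m + (\<mu> - x)\<^sup>2))" for \<epsilon>
      using sums_add[OF sums_add[OF
            sums_mult[OF poisson_weight_sums[of "real m * \<mu>"], of "\<epsilon> * (1 + 2 * ?w\<^sup>2)"]
            sums_mult[OF S(1), of "\<epsilon> * (2 * ?w\<^sup>2)"]]
          sums_mult[OF poisson_second_moment[OF m, of \<mu> x], of "inverse \<epsilon>"]]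
      by (simp add: algebra_simps)
    have le: "?p k * (?w * ?e k)
        \<le> ?p k * (\<epsilon> * (1 + ?w\<^sup>2 * (2 * (1 + ?s k ^ (2 * N)))) + inverse \<epsilon> * (?s k - x)\<^sup>2)"
      if "0 < \<epsilon>" for \<epsilon> k
      by (intro mult_left_mono p0 bound that)
    \<comment> \<open>For convergence alone the choice \<open>\<epsilon> = 1\<close>
      suffices.\<close>
    have "summable (\<lambda>k. ?p k * (?w * ?e k))"
    proof (rule summable_comparison_test'[of _ 0])
      show "summable (\<lambda>k. ?p k * (1 * (1 + ?w\<^sup>2 * (2 * (1 + ?s k ^ (2 * N)))) + inverse 1 * (?s k - x)\<^sup>2))"
        using rhs[of 1] by (rule sums_summable)
      show "norm (?p k * (?w * ?e k))
          \<le> ?p k * (1 * (1 + ?w\<^sup>2 * (2 * (1 + ?s k ^ (2 * N)))) + inverse 1 * (?s k - x)\<^sup>2)" for k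
      proof -
        have "0 \<le> ?p k * (?w * ?e k)"
          by (intro mult_nonneg_nonneg p0 e0 less_imp_le[OF w0])
        then have "norm (?p k * (?w * ?e k)) = ?p k * (?w * ?e k)"
          unfolding real_norm_def by (rule abs_of_nonneg)
        then show ?thesis using le[of 1 k] by (simp only: zero_less_one)
      qed
    qed
    then obtain T where T: "(\<lambda>k. ?p k * (?w * ?e k)) sums T"
      by (auto simp: summable_def)
    have \<delta>0: "0 \<le> delta' m x" using x0 by (simp add: delta'_def)
    have "T \<le> ?C * \<epsilon>" if \<epsilon>: "delta' m x < \<epsilon>" for \<epsilon>
    proof -
      have \<epsilon>0: "0 < \<epsilon>" using \<epsilon> \<delta>0 by simp
      have "T \<le> \<epsilon> * (1 + 2 * ?w\<^sup>2 + 2 * ?w\<^sup>2 * S) + inverse \<epsilon> * (\<mu> / m + (\<mu> - x)\<^sup>2)"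
        by (rule sums_le[OF le[OF \<epsilon>0] T rhs])
      also have "\<dots> \<le> \<epsilon> * (3 + C * 8) + V * \<epsilon>"
      proof (rule add_mono)
        have "?w\<^sup>2 * S \<le> ?w\<^sup>2 * (C * (1 + x ^ (2 * N)))"
          by (intro mult_left_mono S(2)) auto
        also have "\<dots> = C * (?w\<^sup>2 * (1 + x ^ (2 * N)))" by simp
        also have "\<dots> \<le> C * 4" by (intro mult_left_mono weight_power2_mult_le x0 C)
        finally have "?w\<^sup>2 * S \<le> C * 4" .
        moreover have "?w\<^sup>2 \<le> 1" using weight_le_1[OF x0, of N] w0 by (simp add: power_le_one)
        ultimately have "1 + 2 * ?w\<^sup>2 + 2 * ?w\<^sup>2 * S \<le> 3 + C * 8" by linarith
        then show "\<epsilon> * (1 + 2 * ?w\<^sup>2 + 2 * ?w\<^sup>2 * S) \<le> \<epsilon> * (3 + C * 8)"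
          using \<epsilon>0 by (intro mult_left_mono) auto
        have "(delta' m x)\<^sup>2 \<le> \<epsilon>\<^sup>2" using \<epsilon> \<delta>0 by (intro power_mono) auto
        then have "\<mu> / m + (\<mu> - x)\<^sup>2 \<le> V * \<epsilon>\<^sup>2"
          using var V by (meson mult_left_mono order_trans)
        then have "inverse \<epsilon> * (\<mu> / m + (\<mu> - x)\<^sup>2) \<le> inverse \<epsilon> * (V * \<epsilon>\<^sup>2)"
          using \<epsilon>0 by (intro mult_left_mono) auto
        also have "\<dots> = V * \<epsilon>"
          using \<epsilon>0 by (simp add: power2_eq_square)
        finally show "inverse \<epsilon> * (\<mu> / m + (\<mu> - x)\<^sup>2) \<le> V * \<epsilon>" .
      qed
      finally show ?thesis by (simp add: algebra_simps)
    qed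
    then have "T / ?C \<le> \<epsilon>" if "delta' m x < \<epsilon>" for \<epsilon>
      using that C V by (simp add: divide_le_eq mult.commute)
    then have "T / ?C \<le> delta' m x" by (rule dense_ge)
    then have "T \<le> ?C * delta' m x"
      using C V by (simp add: divide_le_eq mult.commute)
    moreover have "(\<lambda>k. ?p k * ?e k) sums (inverse ?w * T)"
    proof -
      have "inverse ?w * (?p k * (?w * ?e k)) = ?p k * ?e k" for k
        using w0 by simp
      then show ?thesis
        using sums_mult[OF T, of "inverse ?w"] by (simp only:)
    qed
    ultimately show ?thesis
      using w0 by (intro exI[of _ "inverse ?w * T"]) (simp add: mult.assoc[symmetric])
  qed
  then show ?thesis using that[of ?C] C V by auto
qed

section \<open>The operator as a Poisson average\<close>

definition mean_factor :: "real \<Rightarrow> nat \<Rightarrow> real" where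
  "mean_factor a m = ln a / (real m * (a powr (1 / real m) - 1))"

text \<open>Both bounds come from \<open>1 + z \<le> exp z\<close>: at \<open>z = t\<close> it gives
  \<open>r \<le> 1\<close>, and at \<open>z = - t\<close> it gives
  \<open>1 - t \<le> exp (- t) \<le> r\<close>.\<close>

lemma mean_factor_bounds:
  assumes a: "1 < a" and m: "1 \<le> m"
  shows "0 \<le> mean_factor a m" and "mean_factor a m \<le> 1" and "1 - ln a / real m \<le> mean_factor a m"
proof -
  define t where "t = ln a / real m"
  have t: "0 < t" using a m by (simp add: t_def)
  have r: "mean_factor a m = t / (exp t - 1)"
    using a by (simp add: mean_factor_def t_def powr_def)
  have pos: "0 < exp t - 1" using t by simp
  show "0 \<le> mean_factor a m" using t by (simp add: r)
  show "mean_factor a m \<le> 1"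
    using pos exp_ge_add_one_self[of t] by (simp add: r del: exp_ge_add_one_self)
  have "1 - t \<le> exp (- t)" using exp_ge_add_one_self[of "- t"] by simp
  also have "exp (- t) \<le> t / (exp t - 1)"
  proof -
    have "exp (- t) * (exp t - 1) = 1 - exp (- t)"
      by (simp add: algebra_simps exp_minus_inverse)
    also have "\<dots> \<le> t" using \<open>1 - t \<le> exp (- t)\<close> by simp
    finally show ?thesis using pos by (simp add: pos_le_divide_eq)
  qed
  finally show "1 - ln a / real m \<le> mean_factor a m" by (simp add: r t_def)
qed

lemma mean_factor_second_moment_le:
  assumes a: "1 < a" and m: "1 \<le> m" and x: "0 \<le> x"
  shows "mean_factor a m * x / real m + (mean_factor a m * x - x)\<^sup>2 \<le> (1 + ln a) * (delta' m x)\<^sup>2"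
proof -
  define r where "r = mean_factor a m"
  have r: "0 \<le> r" "r \<le> 1" "1 - ln a / real m \<le> r"
    using mean_factor_bounds[OF a m] by (simp_all add: r_def)
  \<comment> \<open>Only one factor is estimated by \<open>ln a / real m\<close>, which already
    matches the order \<open>1 / m\<close> of the variance.\<close>
  have "(1 - r)\<^sup>2 \<le> (1 - r) * 1"
    unfolding power2_eq_square using r by (intro mult_left_mono) auto
  also have "\<dots> \<le> ln a / real m" using r by simp
  finally have "(1 - r)\<^sup>2 * x\<^sup>2 \<le> ln a / real m * x\<^sup>2"
    by (intro mult_right_mono) auto
  moreover have "(r * x - x)\<^sup>2 = (1 - r)\<^sup>2 * x\<^sup>2"
    by (simp add: power2_eq_square algebra_simps)
  moreover have "r * x / real m \<le> x / real m"
    using r x m by (intro divide_right_mono mult_left_le_one_le) auto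
  moreover have "x / real m + ln a / real m * x\<^sup>2 \<le> (1 + ln a) * (delta' m x)\<^sup>2"
  proof -
    have "(1 + ln a) * (delta' m x)\<^sup>2 = (1 + ln a) * (x * (1 + x) / real m)"
      using x by (simp add: delta'_def)
    also have "\<dots> = x / real m + ln a / real m * x\<^sup>2 + (x\<^sup>2 / real m + ln a * x / real m)"
      using m by (simp add: field_simps power2_eq_square)
    finally show ?thesis using x a by simp
  qed
  ultimately show ?thesis unfolding r_def by linarith
qed

lemma poisson_weight_mean_factor:
  assumes a: "1 < a" and m: "1 \<le> m"
  shows "poisson_weight (real m * (mean_factor a m * x)) k
    = a powr (- x / (a powr (1 / real m) - 1)) * (x ^ k * ln a ^ k / ((a powr (1 / real m) - 1) ^ k * fact k))"
proof -
  have "real m * (mean_factor a m * x) = x * ln a / (a powr (1 / real m) - 1)"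
    using m by (simp add: mean_factor_def)
  moreover have "a powr (- x / (a powr (1 / real m) - 1)) = exp (- (x * ln a / (a powr (1 / real m) - 1)))"
    using a by (simp add: powr_def)
  ultimately show ?thesis
    by (simp add: poisson_weight_def power_divide power_mult_distrib)
qed

text \<open>In each variable this is the Szasz-Mirakyan operator evaluated at the contracted point
  \<open>mean_factor a m * x\<close>.\<close>

lemma Y_op_eq:
  assumes a: "1 < a" and m: "1 \<le> m" and n: "1 \<le> n"
  shows "Y_op a m n f (x, y) = (\<Sum>k. \<Sum>l. poisson_weight (real m * (mean_factor a m * x)) k *
    poisson_weight (real n * (mean_factor a n * y)) l * f (real k / real m, real l / real n))"
  unfolding Y_op_def poisson_weight_mean_factor[OF a m] poisson_weight_mean_factor[OF a n] prod.case
  by (simp add: power_add mult_ac)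

section \<open>Increments of functions with weighted derivative bounds\<close>

text \<open>Membership in \<open>wspace\<close> makes the weighted image bounded, so the supremum in
  \<open>wnorm\<close> is a genuine upper bound; dividing by the positive weights gives the
  pointwise form.\<close>

lemma wnorm_upper:
  assumes f: "f \<in> wspace N1 N2" and "0 \<le> x" "0 \<le> y"
  shows "\<bar>f (x, y)\<bar> \<le> wnorm N1 N2 f * (inverse (weight N1 x) * inverse (weight N2 y))"
proof -
  have mem: "(x, y) \<in> quadrant" using assms by (simp add: quadrant_def)
  have nonneg: "0 \<le> weight2 N1 N2 p" if "p \<in> quadrant" for p
    using that by (auto simp: quadrant_def weight2_def intro!: mult_nonneg_nonneg less_imp_le[OF weight_pos])
  have "bounded ((\<lambda>p. weight2 N1 N2 p * f p) ` quadrant)"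
    using f unfolding wspace_def by blast
  then obtain B where B: "\<And>p. p \<in> quadrant \<Longrightarrow> \<bar>weight2 N1 N2 p * f p\<bar> \<le> B"
    unfolding bounded_iff real_norm_def by blast
  have "weight2 N1 N2 p * \<bar>f p\<bar> \<le> B" if "p \<in> quadrant" for p
    using B[OF that] nonneg[OF that] by (simp add: abs_mult)
  then have "bdd_above ((\<lambda>p. weight2 N1 N2 p * \<bar>f p\<bar>) ` quadrant)"
    by (rule bdd_aboveI2)
  then have "weight2 N1 N2 (x, y) * \<bar>f (x, y)\<bar> \<le> wnorm N1 N2 f"
    unfolding wnorm_def by (intro cSUP_upper mem)
  moreover have "0 < weight N1 x * weight N2 y"
    using assms by (simp add: weight_pos)
  ultimately have "\<bar>f (x, y)\<bar> \<le> wnorm N1 N2 f / (weight N1 x * weight N2 y)"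
    by (simp add: weight2_def pos_le_divide_eq mult.commute)
  then show ?thesis
    by (simp add: divide_inverse)
qed

lemma wnorm_nonneg:
  assumes "f \<in> wspace N1 N2"
  shows "0 \<le> wnorm N1 N2 f"
proof -
  have "0 < inverse (weight N1 0) * inverse (weight N2 0)"
    by (simp add: weight_pos)
  moreover have "0 \<le> wnorm N1 N2 f * (inverse (weight N1 0) * inverse (weight N2 0))"
    using wnorm_upper[OF assms, of 0 0] by simp
  ultimately show ?thesis
    by (metis mult_neg_pos not_le)
qed

text \<open>Mean value inequality on the segment from \<open>x\<close> to \<open>s\<close>. The
  reciprocal weight increases, so its maximum there is at the larger endpoint; the sum over both
  endpoints dominates it whatever their order.\<close>

lemma weighted_increment_le:
  fixes g :: "real \<Rightarrow> real"
  assumes diff: "\<And>u. 0 \<le> u \<Longrightarrow> g differentiable (at u within {0..})"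
    and bound: "\<And>u. 0 \<le> u \<Longrightarrow> \<bar>vector_derivative g (at u within {0..})\<bar> \<le> A * inverse (weight N u)"
    and A: "0 \<le> A" and x: "0 \<le> x" and s: "0 \<le> s"
  shows "\<bar>g s - g x\<bar> \<le> A * (\<bar>s - x\<bar> * (inverse (weight N x) + inverse (weight N s)))"
proof -
  let ?B = "A * (inverse (weight N x) + inverse (weight N s))"
  have seg: "0 \<le> u \<and> u \<le> max x s" if "u \<in> closed_segment x s" for u
    using that x s by (auto simp: closed_segment_eq_real_ivl split: if_splits)
  have "norm (g s - g x) \<le> ?B * norm (s - x)"
  proof (rule field_differentiable_bound)
    show "convex (closed_segment x s)" by (rule convex_closed_segment)
    \<comment> \<open>Restricting from \<open>{0..}\<close> to the segment covers the one-sided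
      derivative at 0 as well.\<close>
    show "(g has_field_derivative vector_derivative g (at u within {0..})) (at u within closed_segment x s)"
      if u: "u \<in> closed_segment x s" for u
    proof -
      have "(g has_vector_derivative vector_derivative g (at u within {0..})) (at u within {0..})"
        using diff seg[OF u] by (simp add: vector_derivative_works)
      then have "(g has_field_derivative vector_derivative g (at u within {0..})) (at u within {0..})"
        by (simp add: has_real_derivative_iff_has_vector_derivative)
      then show ?thesis
        by (rule DERIV_subset) (use seg in auto)
    qed
    show "norm (vector_derivative g (at u within {0..})) \<le> ?B" if u: "u \<in> closed_segment x s" for u
    proof -
      have "inverse (weight N u) \<le> inverse (weight N (max x s))"
        using seg[OF u] by (intro inverse_weight_mono) auto
      also have "\<dots> \<le> inverse (weight N x) + inverse (weight N s)"
        using weight_pos[OF x, of N] weight_pos[OF s, of N] by (simp add: max_def)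
      finally have "A * inverse (weight N u) \<le> ?B"
        using A by (rule mult_left_mono)
      then show ?thesis
        using bound[of u] seg[OF u] by simp
    qed
  qed auto
  then show ?thesis by (simp add: mult_ac)
qed

text \<open>The path runs from \<open>(x, y)\<close> to \<open>(x, t)\<close> to
  \<open>(s, t)\<close>. The first leg stays at abscissa \<open>x\<close>, so its bound is
  independent of \<open>s\<close>; the bound on the second leg is a function of \<open>s\<close>
  times a function of \<open>t\<close>, the form required for the double average.\<close>

lemma wspace1_increment_le:
  assumes f: "f \<in> wspace1 N1 N2" and nonneg: "0 \<le> x" "0 \<le> y" "0 \<le> s" "0 \<le> t"
  shows "\<bar>f (s, t) - f (x, y)\<bar>
    \<le> wnorm N1 N2 (partial_x f) *
        ((\<bar>s - x\<bar> * (inverse (weight N1 x) + inverse (weight N1 s))) * inverse (weight N2 t))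
      + (wnorm N1 N2 (partial_y f) * inverse (weight N1 x)) *
        (\<bar>t - y\<bar> * (inverse (weight N2 y) + inverse (weight N2 t)))"
proof -
  have dx: "partial_x f \<in> wspace N1 N2" and dy: "partial_y f \<in> wspace N1 N2"
    using f by (auto simp: wspace1_def)
  have diff: "(\<lambda>u. f (u, v)) differentiable (at u within {0..})"
    "(\<lambda>v. f (u, v)) differentiable (at v within {0..})" if "0 \<le> u" "0 \<le> v" for u v
    using f that by (auto simp: wspace1_def quadrant_def)
  let ?A = "wnorm N1 N2 (partial_x f)" and ?B = "wnorm N1 N2 (partial_y f)"
  have "\<bar>f (s, t) - f (x, t)\<bar> \<le> (?A * inverse (weight N2 t)) *
      (\<bar>s - x\<bar> * (inverse (weight N1 x) + inverse (weight N1 s)))"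
  proof (rule weighted_increment_le[where g = "\<lambda>u. f (u, t)", OF diff(1)[OF _ nonneg(4)]])
    show "\<bar>vector_derivative (\<lambda>u. f (u, t)) (at u within {0..})\<bar>
        \<le> ?A * inverse (weight N2 t) * inverse (weight N1 u)" if "0 \<le> u" for u
      using wnorm_upper[OF dx that nonneg(4)] by (simp add: partial_x_def mult_ac)
    show "0 \<le> ?A * inverse (weight N2 t)"
      using wnorm_nonneg[OF dx] weight_pos[OF nonneg(4), of N2] by simp
  qed (use nonneg in auto)
  moreover have "\<bar>f (x, t) - f (x, y)\<bar> \<le> (?B * inverse (weight N1 x)) *
      (\<bar>t - y\<bar> * (inverse (weight N2 y) + inverse (weight N2 t)))"
  proof (rule weighted_increment_le[where g = "\<lambda>v. f (x, v)", OF diff(2)[OF nonneg(1)]])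
    show "\<bar>vector_derivative (\<lambda>v. f (x, v)) (at v within {0..})\<bar>
        \<le> ?B * inverse (weight N1 x) * inverse (weight N2 v)" if "0 \<le> v" for v
      using wnorm_upper[OF dy nonneg(1) that] by (simp add: partial_y_def mult_ac)
    show "0 \<le> ?B * inverse (weight N1 x)"
      using wnorm_nonneg[OF dy] weight_pos[OF nonneg(1), of N1] by simp
  qed (use nonneg in auto)
  ultimately show ?thesis by (simp add: mult_ac)
qed

section \<open>Combination of the one-variable averages into the bound in both variables\<close>

theorem theorem3p1:
  fixes a :: real and N1 N2 :: nat
  assumes "a > 1"
  shows "\<exists>M5 > 0. \<forall>f \<in> wspace1 N1 N2. \<forall>(x, y) \<in> quadrant. \<forall>m \<ge> 1. \<forall>n \<ge> 1.
    weight2 N1 N2 (x, y) * \<bar>Y_op a m n f (x, y) - f (x, y)\<bar>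
      \<le> M5 * (wnorm N1 N2 (partial_x f) * delta' m x + wnorm N1 N2 (partial_y f) * delta' n y)"
proof -
  have V: "0 \<le> 1 + ln a" using assms by simp
  obtain C1 where C1: "0 < C1" and dev1: "\<And>m \<mu> x. \<lbrakk>1 \<le> m; 0 \<le> \<mu>; \<mu> \<le> x;
      \<mu> / real m + (\<mu> - x)\<^sup>2 \<le> (1 + ln a) * (delta' m x)\<^sup>2\<rbrakk> \<Longrightarrow>
      \<exists>G. (\<lambda>k. poisson_weight (real m * \<mu>) k *
            (\<bar>real k / real m - x\<bar> * (inverse (weight N1 x) + inverse (weight N1 (real k / real m))))) sums G \<and>
        weight N1 x * G \<le> C1 * delta' m x"
    by (rule poisson_weighted_deviation_bound[OF V, of N1]) (rule that)
  obtain C2 where C2: "0 < C2" and dev2: "\<And>m \<mu> x. \<lbrakk>1 \<le> m; 0 \<le> \<mu>; \<mu> \<le> x;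
      \<mu> / real m + (\<mu> - x)\<^sup>2 \<le> (1 + ln a) * (delta' m x)\<^sup>2\<rbrakk> \<Longrightarrow>
      \<exists>G. (\<lambda>k. poisson_weight (real m * \<mu>) k *
            (\<bar>real k / real m - x\<bar> * (inverse (weight N2 x) + inverse (weight N2 (real k / real m))))) sums G \<and>
        weight N2 x * G \<le> C2 * delta' m x"
    by (rule poisson_weighted_deviation_bound[OF V, of N2]) (rule that)
  obtain D where D: "0 < D" and wt: "\<And>m \<mu> x. \<lbrakk>1 \<le> m; 0 \<le> \<mu>; \<mu> \<le> x\<rbrakk> \<Longrightarrow>
      \<exists>H. (\<lambda>k. poisson_weight (real m * \<mu>) k * inverse (weight N2 (real k / real m))) sums H \<and>
        weight N2 x * H \<le> D"
    by (rule poisson_inverse_weight_bound[of N2]) (rule that)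
  \<comment> \<open>The x-increment costs \<open>C1\<close> for its own average and \<open>D\<close>
    for the reciprocal weight at the random second coordinate; the y-increment costs
    \<open>C2\<close>. The sum serves as common constant.\<close>
  have "weight2 N1 N2 (x, y) * \<bar>Y_op a m n f (x, y) - f (x, y)\<bar>
      \<le> (C1 * D + C2) * (wnorm N1 N2 (partial_x f) * delta' m x + wnorm N1 N2 (partial_y f) * delta' n y)"
    if f: "f \<in> wspace1 N1 N2" and x: "0 \<le> x" and y: "0 \<le> y" and m: "1 \<le> m" and n: "1 \<le> n" for f x y m n
  proof -
    define \<mu> where "\<mu> = mean_factor a m * x"
    define \<nu> where "\<nu> = mean_factor a n * y"
    define A where "A = wnorm N1 N2 (partial_x f)"
    define B where "B = wnorm N1 N2 (partial_y f)"
    have \<mu>: "0 \<le> \<mu>" "\<mu> \<le> x" and \<nu>: "0 \<le> \<nu>" "\<nu> \<le> y"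
      using mean_factor_bounds[OF assms m] mean_factor_bounds[OF assms n] x y
      by (simp_all add: \<mu>_def \<nu>_def mult_left_le_one_le)
    have A: "0 \<le> A" and B: "0 \<le> B"
      using f by (auto simp: A_def B_def wspace1_def intro: wnorm_nonneg)
    have w: "0 < weight N1 x" "0 < weight N2 y" using x y by (auto intro: weight_pos)
    have \<delta>: "0 \<le> delta' m x" "0 \<le> delta' n y" using x y by (simp_all add: delta'_def)
    obtain G where G: "(\<lambda>k. poisson_weight (real m * \<mu>) k *
            (\<bar>real k / real m - x\<bar> * (inverse (weight N1 x) + inverse (weight N1 (real k / real m))))) sums G"
        "weight N1 x * G \<le> C1 * delta' m x"
      using dev1[OF m \<mu> mean_factor_second_moment_le[OF assms m x, folded \<mu>_def]] by blast
    obtain U where U: "(\<lambda>k. poisson_weight (real n * \<nu>) k *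
            (\<bar>real k / real n - y\<bar> * (inverse (weight N2 y) + inverse (weight N2 (real k / real n))))) sums U"
        "weight N2 y * U \<le> C2 * delta' n y"
      using dev2[OF n \<nu> mean_factor_second_moment_le[OF assms n y, folded \<nu>_def]] by blast
    obtain H where H: "(\<lambda>k. poisson_weight (real n * \<nu>) k * inverse (weight N2 (real k / real n))) sums H"
        "weight N2 y * H \<le> D"
      using wt[OF n \<nu>] by blast
    \<comment> \<open>Needed to multiply the bounds on \<open>weight N1 x * G\<close> and
      \<open>weight N2 y * H\<close>.\<close>
    have H0: "0 \<le> H"
    proof (rule sums_le[OF _ sums_zero H(1)])
      show "0 \<le> poisson_weight (real n * \<nu>) k * inverse (weight N2 (real k / real n))" for k
        using \<nu> weight_pos[of "real k / real n" N2] by (simp add: poisson_weight_nonneg)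
    qed
    have "\<bar>Y_op a m n f (x, y) - f (x, y)\<bar> \<le> A * (G * H) + (B * inverse (weight N1 x)) * U"
      unfolding Y_op_eq[OF assms m n] \<mu>_def[symmetric] \<nu>_def[symmetric]
    proof (rule double_average_deviation[OF _ poisson_weight_sums _ poisson_weight_sums _ G(1) H(1) U(1)])
      show "\<bar>f (real k / real m, real l / real n) - f (x, y)\<bar>
        \<le> A * ((\<bar>real k / real m - x\<bar> * (inverse (weight N1 x) + inverse (weight N1 (real k / real m))))
              * inverse (weight N2 (real l / real n)))
          + (B * inverse (weight N1 x)) *
            (\<bar>real l / real n - y\<bar> * (inverse (weight N2 y) + inverse (weight N2 (real l / real n))))" for k l
        unfolding A_def B_def by (rule wspace1_increment_le[OF f x y]) auto
    qed (use \<mu> \<nu> in \<open>auto intro: poisson_weight_nonneg\<close>)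
    then have "weight2 N1 N2 (x, y) * \<bar>Y_op a m n f (x, y) - f (x, y)\<bar>
        \<le> weight N1 x * weight N2 y * (A * (G * H) + (B * inverse (weight N1 x)) * U)"
      using w by (simp add: weight2_def mult_left_mono)
    \<comment> \<open>In the y-term \<open>weight N1 x\<close> cancels against its inverse; in the
      x-term each weight is paired with the average it compensates.\<close>
    also have "\<dots> = A * ((weight N1 x * G) * (weight N2 y * H)) + B * (weight N2 y * U)"
      using w by (simp add: field_simps)
    also have "\<dots> \<le> A * ((C1 * delta' m x) * D) + B * (C2 * delta' n y)"
    proof -
      have "(weight N1 x * G) * (weight N2 y * H) \<le> (C1 * delta' m x) * D"
        by (rule mult_mono) (use C1 G(2) H(2) H0 w \<delta> in auto)
      then show ?thesis
        using A B U(2) by (intro add_mono mult_left_mono)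
    qed
    also have "\<dots> = (C1 * D) * (A * delta' m x) + C2 * (B * delta' n y)" by simp
    also have "\<dots> \<le> (C1 * D + C2) * (A * delta' m x) + (C1 * D + C2) * (B * delta' n y)"
      using A B C1 C2 D \<delta> by (intro add_mono mult_right_mono) auto
    finally show ?thesis by (simp add: A_def B_def algebra_simps)
  qed
  moreover have "0 < C1 * D + C2"
    using C1 C2 D by (simp add: add_pos_pos)
  ultimately show ?thesis
    unfolding quadrant_def by blast
qed

end
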